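(* Let $P$ be a process such that $\vdash P \triangleright \mathtt{l}:\mathtt{end},\ \mathtt{r}:\mathtt{end}$ is derivable in the empty typing environment. Then $P$ is correct, i.e. whenever $P \longrightarrow^* Q$ and $Q$ has no reduction ($Q \not\longrightarrow$), we have $Q \equiv \mathbf{0}$.
   Context: Channels: $\mathsf{c}$ ranges over $\{\mathtt{l},\mathtt{r}\}$, with involution $\bar{\mathtt{l}}=\mathtt{r}$, $\bar{\mathtt{r}}=\mathtt{l}$. Selectors: $\ell\in\{\mathsf{inl},\mathsf{inr}\}$. There are basic values and basic types, including the value $()$ of type $\mathsf{unit}$, the booleans $\mathsf{true},\mathsf{false}$ of type $\mathsf{bool}$, and the integers of type $\mathsf{int}$; $v\in t$ means that the basic value $v$ has basic type $t$. Expressions $e$ are variables $x$, basic values $v$, or equalities $e_1=e_2$; a deterministic evaluation relation $e\Downarrow v$ states that $v$ is the value of $e$. Processes: $P ::= \mathbf{0} \mid \mathsf{c}?(x:t).P \mid \mathsf{c}!e.P \mid \mathsf{c}\triangleleft\ell.P \mid \mathsf{c}\triangleright\{P,Q\} \mid \mathsf{if}\ e\ \mathsf{then}\ P\ \mathsf{else}\ Q \mid P\bowtie Q$ (input, output, selection, branching with an $\mathsf{inl}$-branch $P$ and an $\mathsf{inr}$-branch $Q$, conditional, composition). In $P\bowtie Q$, messages sent by $P$ on $\mathtt{r}$ are received by $Q$ on $\mathtt{l}$ and vice versa. Structural congruence $\equiv$ is the least congruence with $\mathbf{0}\bowtie\mathbf{0}\equiv\mathbf{0}$ and $P\bowtie(Q\bowtie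 R)\equiv(P\bowtie Q)\bowtie R$. Reduction contexts: $\mathcal{C} ::= [\,] \mid \mathcal{C}\bowtie P \mid P\bowtie\mathcal{C}$. Reduction $\longrightarrow$ is the least relation with: $\mathtt{r}!e.P\bowtie\mathtt{l}?(x:t).Q \longrightarrow P\bowtie Q\{v/x\}$ and $\mathtt{r}?(x:t).P\bowtie\mathtt{l}!e.Q\longrightarrow P\{v/x\}\bowtie Q$, both when $e\Downarrow v$ and $v\in t$; $\mathtt{r}\triangleleft\ell.P\bowtie\mathtt{l}\triangleright\{Q_{\mathsf{inl}},Q_{\mathsf{inr}}\}\longrightarrow P\bowtie Q_\ell$; $\mathtt{r}\triangleright\{P_{\mathsf{inl}},P_{\mathsf{inr}}\}\bowtie\mathtt{l}\triangleleft\ell.Q\longrightarrow P_\ell\bowtie Q$; $\mathsf{if}\ e\ \mathsf{then}\ P_{\mathsf{true}}\ \mathsf{else}\ P_{\mathsf{false}}\longrightarrow P_v$ when $e\Downarrow v$, $v\in\mathsf{bool}$; closure under reduction contexts; and closure under $\equiv$ on both sides. $\longrightarrow^*$ is the reflexive-transitive closure. Session types: $T ::= \mathtt{end} \mid ?t.T \mid !t.T \mid T+S \mid T\oplus S$ (input, output, branching, selection). Typing environments $\Gamma$ map variables to basic types. Judgments: $\Gamma\vdash e:t$, and $\Gamma\vdash P\triangleright \mathsf{c}:T,\bar{\mathsf{c}}:S$ meaning $P$ uses channel $\mathsf{c}$ according to $T$ and $\bar{\mathsf{c}}$ according to $S$. Rules: $\Gamma,x:t\vdash x:t$; $\Gamma\vdash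 v:t$ if $v\in t$; $\Gamma\vdash e_1=e_2:\mathsf{bool}$ if $\Gamma\vdash e_1:t$ and $\Gamma\vdash e_2:t$. If $\Gamma,x:t\vdash P\triangleright\mathsf{c}:T,\bar{\mathsf{c}}:S$ then $\Gamma\vdash\mathsf{c}?(x:t).P\triangleright\mathsf{c}:?t.T,\bar{\mathsf{c}}:S$. If $\Gamma\vdash e:t$ and $\Gamma\vdash P\triangleright\mathsf{c}:T,\bar{\mathsf{c}}:S$ then $\Gamma\vdash\mathsf{c}!e.P\triangleright\mathsf{c}:!t.T,\bar{\mathsf{c}}:S$. If $\Gamma\vdash P_i\triangleright\mathsf{c}:T_i,\bar{\mathsf{c}}:S$ for $i=1,2$ then $\Gamma\vdash\mathsf{c}\triangleright\{P_1,P_2\}\triangleright\mathsf{c}:T_1+T_2,\bar{\mathsf{c}}:S$. If $\Gamma\vdash P\triangleright\mathsf{c}:T_1,\bar{\mathsf{c}}:S$ then $\Gamma\vdash\mathsf{c}\triangleleft\mathsf{inl}.P\triangleright\mathsf{c}:T_1\oplus T_2,\bar{\mathsf{c}}:S$; if $\Gamma\vdash P\triangleright\mathsf{c}:T_2,\bar{\mathsf{c}}:S$ then $\Gamma\vdash\mathsf{c}\triangleleft\mathsf{inr}.P\triangleright\mathsf{c}:T_1\oplus T_2,\bar{\mathsf{c}}:S$. $\Gamma\vdash\mathbf{0}\triangleright\mathtt{l}:\mathtt{end},\mathtt{r}:\mathtt{end}$. If $\Gamma\vdash e:\mathsf{bool}$ and $\Gamma\vdash P_i\triangleright\mathtt{l}:T,\mathtt{r}:S$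 ($i=1,2$) then $\Gamma\vdash\mathsf{if}\ e\ \mathsf{then}\ P_1\ \mathsf{else}\ P_2\triangleright\mathtt{l}:T,\mathtt{r}:S$. If $\Gamma\vdash P\triangleright\mathtt{l}:T,\mathtt{r}:T'$ and $\Gamma\vdash Q\triangleright\mathtt{l}:\overline{T'},\mathtt{r}:S$ then $\Gamma\vdash P\bowtie Q\triangleright\mathtt{l}:T,\mathtt{r}:S$, where $\overline{T'}$ is the dual of $T'$ (obtained by swapping inputs with outputs and branchings with selections). *)

theory Defs imports Main begin

datatype chan = ChL | ChR

fun co :: "chan \<Rightarrow> chan" where
  "co ChL = ChR"
| "co ChR = ChL"

datatype sel = inl | inr

fun pick :: "sel \<Rightarrow> 'a \<Rightarrow> 'a \<Rightarrow> 'a" where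
  "pick inl a b = a"
| "pick inr a b = b"

text \<open>
  The universe of basic values and basic types is open-ended: it contains the unit value, the
  booleans and the integers, together with arbitrary further values (\<open>'v\<close>) and types (\<open>'t\<close>).
  The relation \<open>M\<close>, an arbitrary parameter of everything below that mentions membership of a
  value in a type, says which values inhabit the further types.
\<close>

datatype 'v bval = VUnit | VBool bool | VInt int | VOther 'v

datatype 't btype = UnitT | BoolT | IntT | OtherT 't

fun has_btype :: "('v bval \<Rightarrow> 't \<Rightarrow> bool) \<Rightarrow> 'v bval \<Rightarrow> 't btype \<Rightarrow> bool" where
  "has_btype M v UnitT \<longleftrightarrow> v = VUnit"
| "has_btype M v BoolT \<longleftrightarrow> (\<exists>b. v = VBool b)"
| "has_btype M v IntT \<longleftrightarrow> (\<exists>i. v = VInt i)"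
| "has_btype M v (OtherT t) \<longleftrightarrow> M v t"

type_synonym vname = string

datatype 'v expr = Var vname | Val "'v bval" | Eq "'v expr" "'v expr"

inductive eval :: "'v expr \<Rightarrow> 'v bval \<Rightarrow> bool" (infix \<open>\<Down>\<close> 50) where
  eval_Val: "Val v \<Down> v"
| eval_Eq: "e1 \<Down> v1 \<Longrightarrow> e2 \<Down> v2 \<Longrightarrow> Eq e1 e2 \<Down> VBool (v1 = v2)"

lemma eval_deterministic: "e \<Down> v \<Longrightarrow> e \<Down> w \<Longrightarrow> v = w"
proof (induction arbitrary: w rule: eval.induct)
  case (eval_Val v)
  then show ?case by (auto elim: eval.cases)
next
  case (eval_Eq e1 v1 e2 v2)
  from eval_Eq.prems show ?case
    by cases (use eval_Eq.IH in blast)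
qed

datatype ('v, 't) proc =
    PNil
  | Inp chan vname "'t btype" "('v, 't) proc"
  | Out chan "'v expr" "('v, 't) proc"
  | Sel chan sel "('v, 't) proc"
  | Bra chan "('v, 't) proc" "('v, 't) proc"
  | Cond "'v expr" "('v, 't) proc" "('v, 't) proc"
  | Comp "('v, 't) proc" "('v, 't) proc"  (infixl \<open>\<bowtie>\<close> 65)

fun esubst :: "vname \<Rightarrow> 'v bval \<Rightarrow> 'v expr \<Rightarrow> 'v expr" where
  "esubst x v (Var y) = (if y = x then Val v else Var y)"
| "esubst x v (Val w) = Val w"
| "esubst x v (Eq e1 e2) = Eq (esubst x v e1) (esubst x v e2)"

text \<open>
  Substitution stops at a binder for the same variable. Only (closed) values are substituted,
  so capture cannot occur and no renaming is needed.
\<close>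

fun subst :: "vname \<Rightarrow> 'v bval \<Rightarrow> ('v, 't) proc \<Rightarrow> ('v, 't) proc" where
  "subst x v PNil = PNil"
| "subst x v (Inp c y t P) = Inp c y t (if y = x then P else subst x v P)"
| "subst x v (Out c e P) = Out c (esubst x v e) (subst x v P)"
| "subst x v (Sel c k P) = Sel c k (subst x v P)"
| "subst x v (Bra c P Q) = Bra c (subst x v P) (subst x v Q)"
| "subst x v (Cond e P Q) = Cond (esubst x v e) (subst x v P) (subst x v Q)"
| "subst x v (P \<bowtie> Q) = subst x v P \<bowtie> subst x v Q"

inductive scong :: "('v, 't) proc \<Rightarrow> ('v, 't) proc \<Rightarrow> bool" (infix \<open>\<cong>\<close> 50) where
  sc_nil: "PNil \<bowtie> PNil \<cong> PNil"
| sc_assoc: "P \<bowtie> (Q \<bowtie> R) \<cong> (P \<bowtie> Q) \<bowtie> R"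
| sc_refl: "P \<cong> P"
| sc_sym: "P \<cong> Q \<Longrightarrow> Q \<cong> P"
| sc_trans: "P \<cong> Q \<Longrightarrow> Q \<cong> R \<Longrightarrow> P \<cong> R"
| sc_Inp: "P \<cong> P' \<Longrightarrow> Inp c x t P \<cong> Inp c x t P'"
| sc_Out: "P \<cong> P' \<Longrightarrow> Out c e P \<cong> Out c e P'"
| sc_Sel: "P \<cong> P' \<Longrightarrow> Sel c k P \<cong> Sel c k P'"
| sc_Bra: "P \<cong> P' \<Longrightarrow> Q \<cong> Q' \<Longrightarrow> Bra c P Q \<cong> Bra c P' Q'"
| sc_Cond: "P \<cong> P' \<Longrightarrow> Q \<cong> Q' \<Longrightarrow> Cond e P Q \<cong> Cond e P' Q'"
| sc_Comp: "P \<cong> P' \<Longrightarrow> Q \<cong> Q' \<Longrightarrow> P \<bowtie> Q \<cong> P' \<bowtie> Q'"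

datatype ('v, 't) rctx =
    Hole
  | CompL "('v, 't) rctx" "('v, 't) proc"
  | CompR "('v, 't) proc" "('v, 't) rctx"

fun plug :: "('v, 't) rctx \<Rightarrow> ('v, 't) proc \<Rightarrow> ('v, 't) proc" where
  "plug Hole P = P"
| "plug (CompL C Q) P = plug C P \<bowtie> Q"
| "plug (CompR Q C) P = Q \<bowtie> plug C P"

inductive red :: "('v bval \<Rightarrow> 't \<Rightarrow> bool) \<Rightarrow> ('v, 't) proc \<Rightarrow> ('v, 't) proc \<Rightarrow> bool"
  for M :: "'v bval \<Rightarrow> 't \<Rightarrow> bool" where
  red_comm_right: "e \<Down> v \<Longrightarrow> has_btype M v t \<Longrightarrow>
    red M (Out ChR e P \<bowtie> Inp ChL x t Q) (P \<bowtie> subst x v Q)"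
| red_comm_left: "e \<Down> v \<Longrightarrow> has_btype M v t \<Longrightarrow>
    red M (Inp ChR x t P \<bowtie> Out ChL e Q) (subst x v P \<bowtie> Q)"
| red_choice_right: "red M (Sel ChR k P \<bowtie> Bra ChL Q1 Q2) (P \<bowtie> pick k Q1 Q2)"
| red_choice_left: "red M (Bra ChR P1 P2 \<bowtie> Sel ChL k Q) (pick k P1 P2 \<bowtie> Q)"
| red_cond: "e \<Down> VBool b \<Longrightarrow> red M (Cond e P Q) (if b then P else Q)"
| red_ctx: "red M P Q \<Longrightarrow> red M (plug C P) (plug C Q)"
| red_struct: "P \<cong> P' \<Longrightarrow> red M P' Q' \<Longrightarrow> Q' \<cong> Q \<Longrightarrow> red M P Q"

definition correct :: "('v bval \<Rightarrow> 't \<Rightarrow> bool) \<Rightarrow> ('v, 't) proc \<Rightarrow> bool" where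
  "correct M P \<longleftrightarrow> (\<forall>Q. (red M)\<^sup>*\<^sup>* P Q \<and> \<not> (\<exists>Q'. red M Q Q') \<longrightarrow> Q \<cong> PNil)"

datatype 't stype =
    End
  | TIn "'t btype" "'t stype"
  | TOut "'t btype" "'t stype"
  | TBra "'t stype" "'t stype"
  | TSel "'t stype" "'t stype"

fun dual :: "'t stype \<Rightarrow> 't stype" where
  "dual End = End"
| "dual (TIn t T) = TOut t (dual T)"
| "dual (TOut t T) = TIn t (dual T)"
| "dual (TBra T S) = TSel (dual T) (dual S)"
| "dual (TSel T S) = TBra (dual T) (dual S)"

type_synonym 't env = "vname \<Rightarrow> 't btype option"

inductive etyped :: "('v bval \<Rightarrow> 't \<Rightarrow> bool) \<Rightarrow> 't env \<Rightarrow> 'v expr \<Rightarrow> 't btype \<Rightarrow> bool"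
  for M :: "'v bval \<Rightarrow> 't \<Rightarrow> bool" and \<Gamma> :: "'t env" where
  et_Var: "\<Gamma> x = Some t \<Longrightarrow> etyped M \<Gamma> (Var x) t"
| et_Val: "has_btype M v t \<Longrightarrow> etyped M \<Gamma> (Val v) t"
| et_Eq: "etyped M \<Gamma> e1 t \<Longrightarrow> etyped M \<Gamma> e2 t \<Longrightarrow> etyped M \<Gamma> (Eq e1 e2) BoolT"

text \<open>
  \<open>session c T S\<close> is the unordered assignment $c : T, \bar c : S$; in particular
  \<open>session ChL T S = session ChR S T\<close>.
\<close>

definition session :: "chan \<Rightarrow> 't stype \<Rightarrow> 't stype \<Rightarrow> chan \<Rightarrow> 't stype" where
  "session c T S = (\<lambda>d. if d = c then T else S)"

lemma session_co: "session (co c) S T = session c T S"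
  by (rule ext, rename_tac d, case_tac c; case_tac d) (simp_all add: session_def)

inductive typed ::
  "('v bval \<Rightarrow> 't \<Rightarrow> bool) \<Rightarrow> 't env \<Rightarrow> ('v, 't) proc \<Rightarrow> (chan \<Rightarrow> 't stype) \<Rightarrow> bool"
  for M :: "'v bval \<Rightarrow> 't \<Rightarrow> bool" where
  t_Nil: "typed M \<Gamma> PNil (session ChL End End)"
| t_Inp: "typed M (\<Gamma>(x \<mapsto> t)) P (session c T S) \<Longrightarrow>
    typed M \<Gamma> (Inp c x t P) (session c (TIn t T) S)"
| t_Out: "etyped M \<Gamma> e t \<Longrightarrow> typed M \<Gamma> P (session c T S) \<Longrightarrow>
    typed M \<Gamma> (Out c e P) (session c (TOut t T) S)"
| t_Bra: "typed M \<Gamma> P1 (session c T1 S) \<Longrightarrow> typed M \<Gamma> P2 (session c T2 S) \<Longrightarrow>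
    typed M \<Gamma> (Bra c P1 P2) (session c (TBra T1 T2) S)"
| t_Sel_inl: "typed M \<Gamma> P (session c T1 S) \<Longrightarrow>
    typed M \<Gamma> (Sel c inl P) (session c (TSel T1 T2) S)"
| t_Sel_inr: "typed M \<Gamma> P (session c T2 S) \<Longrightarrow>
    typed M \<Gamma> (Sel c inr P) (session c (TSel T1 T2) S)"
| t_Cond: "etyped M \<Gamma> e BoolT \<Longrightarrow>
    typed M \<Gamma> P1 (session ChL T S) \<Longrightarrow> typed M \<Gamma> P2 (session ChL T S) \<Longrightarrow>
    typed M \<Gamma> (Cond e P1 P2) (session ChL T S)"
| t_Comp: "typed M \<Gamma> P (session ChL T T') \<Longrightarrow> typed M \<Gamma> Q (session ChL (dual T') S) \<Longrightarrow>
    typed M \<Gamma> (P \<bowtie> Q) (session ChL T S)"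

end

theory Submission imports Defs begin

text \<open>
  Typing is invariant under structural congruence and preserved by reduction, so it suffices to
  show that a closed, typed, irreducible process of type \<open>l : end, r : end\<close> is congruent to
  \<open>PNil\<close>. This is proved for arbitrary session types in the following form: a closed, typed,
  irreducible process is congruent to \<open>PNil\<close>, or its leftmost component is a prefix on \<open>l\<close>, or
  its rightmost component is a prefix on \<open>r\<close>. For a composition \<open>P \<bowtie> Q\<close> the only other
  possibilities are that \<open>P\<close> ends in a prefix on \<open>r\<close> and \<open>Q\<close> begins with a prefix on \<open>l\<close>,
  which by duality form a redex, or that exactly one of these prefixes faces a process congruent
  to \<open>PNil\<close>, which is impossible since a channel with a pending prefix does not have type \<open>end\<close>.
\<close>

section \<open>Inversion of the typing rules\<close>

lemma session_upd: "(session c T S)(c := U) = session c U S"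
  by (auto simp: session_def)

lemma session_eta: "session c (s c) (s (co c)) = s"
proof
  fix d show "session c (s c) (s (co c)) d = s d"
    by (cases c; cases d) (simp_all add: session_def)
qed

lemma session_same: "session c T S c = T"
  by (simp add: session_def)

text \<open>Bridge between two notations: the rules of \<open>typed\<close> speak of
  \<open>session c T S\<close>, the inversions below of an arbitrary \<open>s\<close> updated at
  \<open>c\<close>, a form that rewrites uniformly for both channels.\<close>

lemma fun_upd_eq_session: "s(c := T) = session c T (s (co c))"
  by (metis session_eta session_upd)

lemma typed_PNil_iff: "typed M \<Gamma> PNil s \<longleftrightarrow> s = (\<lambda>_. End)"
proof
  assume "typed M \<Gamma> PNil s"
  then show "s = (\<lambda>_. End)"
    by cases (auto simp: session_def)
next
  assume "s = (\<lambda>_. End)"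
  then have "s = session ChL End End"
    by (auto simp: session_def)
  then show "typed M \<Gamma> PNil s"
    by (simp add: t_Nil)
qed

lemma typed_Inp_iff:
  "typed M \<Gamma> (Inp c x t P) s \<longleftrightarrow> (\<exists>T. s c = TIn t T \<and> typed M (\<Gamma>(x \<mapsto> t)) P (s(c := T)))"
proof
  assume "typed M \<Gamma> (Inp c x t P) s"
  then show "\<exists>T. s c = TIn t T \<and> typed M (\<Gamma>(x \<mapsto> t)) P (s(c := T))"
    by cases (auto simp: session_upd session_same)
next
  assume "\<exists>T. s c = TIn t T \<and> typed M (\<Gamma>(x \<mapsto> t)) P (s(c := T))"
  then show "typed M \<Gamma> (Inp c x t P) s"
    by (metis fun_upd_eq_session session_eta t_Inp)
qed

lemma typed_Out_iff:
  "typed M \<Gamma> (Out c e P) s \<longleftrightarrow>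
    (\<exists>t T. s c = TOut t T \<and> etyped M \<Gamma> e t \<and> typed M \<Gamma> P (s(c := T)))"
proof
  assume "typed M \<Gamma> (Out c e P) s"
  then show "\<exists>t T. s c = TOut t T \<and> etyped M \<Gamma> e t \<and> typed M \<Gamma> P (s(c := T))"
    by cases (auto simp: session_upd session_same)
next
  assume "\<exists>t T. s c = TOut t T \<and> etyped M \<Gamma> e t \<and> typed M \<Gamma> P (s(c := T))"
  then show "typed M \<Gamma> (Out c e P) s"
    by (metis fun_upd_eq_session session_eta t_Out)
qed

lemma typed_Bra_iff:
  "typed M \<Gamma> (Bra c P Q) s \<longleftrightarrow>
    (\<exists>T S. s c = TBra T S \<and> typed M \<Gamma> P (s(c := T)) \<and> typed M \<Gamma> Q (s(c := S)))"
proof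
  assume "typed M \<Gamma> (Bra c P Q) s"
  then show "\<exists>T S. s c = TBra T S \<and> typed M \<Gamma> P (s(c := T)) \<and> typed M \<Gamma> Q (s(c := S))"
    by cases (auto simp: session_upd session_same)
next
  assume "\<exists>T S. s c = TBra T S \<and> typed M \<Gamma> P (s(c := T)) \<and> typed M \<Gamma> Q (s(c := S))"
  then show "typed M \<Gamma> (Bra c P Q) s"
    by (metis fun_upd_eq_session session_eta t_Bra)
qed

lemma typed_Sel_iff:
  "typed M \<Gamma> (Sel c k P) s \<longleftrightarrow> (\<exists>T S. s c = TSel T S \<and> typed M \<Gamma> P (s(c := pick k T S)))"
proof
  assume "typed M \<Gamma> (Sel c k P) s"
  then show "\<exists>T S. s c = TSel T S \<and> typed M \<Gamma> P (s(c := pick k T S))"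
    by cases (auto simp: session_upd session_same)
next
  assume "\<exists>T S. s c = TSel T S \<and> typed M \<Gamma> P (s(c := pick k T S))"
  then show "typed M \<Gamma> (Sel c k P) s"
    by (cases k) (metis fun_upd_eq_session session_eta t_Sel_inl t_Sel_inr pick.simps)+
qed

lemma typed_Cond_iff:
  "typed M \<Gamma> (Cond e P Q) s \<longleftrightarrow> etyped M \<Gamma> e BoolT \<and> typed M \<Gamma> P s \<and> typed M \<Gamma> Q s"
proof
  assume "typed M \<Gamma> (Cond e P Q) s"
  then show "etyped M \<Gamma> e BoolT \<and> typed M \<Gamma> P s \<and> typed M \<Gamma> Q s"
    by cases auto
next
  assume "etyped M \<Gamma> e BoolT \<and> typed M \<Gamma> P s \<and> typed M \<Gamma> Q s"
  then show "typed M \<Gamma> (Cond e P Q) s"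
    by (metis session_eta t_Cond)
qed

lemma typed_Comp_iff:
  "typed M \<Gamma> (P \<bowtie> Q) s \<longleftrightarrow>
    (\<exists>T. typed M \<Gamma> P (s(ChR := T)) \<and> typed M \<Gamma> Q (s(ChL := dual T)))"
proof -
  \<comment> \<open>\<open>t_Comp\<close> lists \<open>ChL\<close> first; \<open>session_co\<close>
    brings the update at \<open>ChR\<close> into that order.\<close>
  have R: "s(ChR := T) = session ChL (s ChL) T" for T
    by (metis co.simps(2) fun_upd_eq_session session_co)
  have L: "s(ChL := T) = session ChL T (s ChR)" for T
    by (metis co.simps(1) fun_upd_eq_session)
  show ?thesis
  proof
    assume "typed M \<Gamma> (P \<bowtie> Q) s"
    then show "\<exists>T. typed M \<Gamma> P (s(ChR := T)) \<and> typed M \<Gamma> Q (s(ChL := dual T))"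
      unfolding R L by cases (auto simp: session_def)
  next
    assume "\<exists>T. typed M \<Gamma> P (s(ChR := T)) \<and> typed M \<Gamma> Q (s(ChL := dual T))"
    then show "typed M \<Gamma> (P \<bowtie> Q) s"
      unfolding R L by (metis co.simps(1) session_eta t_Comp)
  qed
qed

lemmas typed_iffs = typed_PNil_iff typed_Inp_iff typed_Out_iff typed_Bra_iff typed_Sel_iff
  typed_Cond_iff typed_Comp_iff

section \<open>Type preservation\<close>

lemma etyped_esubst:
  assumes "etyped M (\<Gamma>(x \<mapsto> t)) e u" and "has_btype M v t"
  shows "etyped M \<Gamma> (esubst x v e) u"
  using assms by induction (auto intro: etyped.intros split: if_splits)

lemma typed_subst:
  assumes "typed M (\<Gamma>(x \<mapsto> t)) P s" and "has_btype M v t"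
  shows "typed M \<Gamma> (subst x v P) s"
  using assms
proof (induction P arbitrary: \<Gamma> s)
  case (Inp c y u P)
  show ?case
  proof (cases "y = x")
    case True
    \<comment> \<open>The inner binder shadows \<open>x\<close>: \<open>subst\<close> leaves the
      body alone, and the second update of the environment overwrites the first.\<close>
    then show ?thesis
      using Inp.prems(1) unfolding typed_Inp_iff subst.simps True fun_upd_upd if_True by simp
  next
    case False
    then have "\<Gamma>(x \<mapsto> t, y \<mapsto> u) = \<Gamma>(y \<mapsto> u, x \<mapsto> t)"
      by (simp add: fun_upd_twist)
    then show ?thesis
      using Inp False unfolding typed_Inp_iff subst.simps by metis
  qed
qed ((unfold typed_iffs subst.simps; metis etyped_esubst)+)

text \<open>An equivalence, so that the induction passes through \<open>sc_sym\<close>.\<close>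

lemma scong_typed_iff: "P \<cong> Q \<Longrightarrow> typed M \<Gamma> P s \<longleftrightarrow> typed M \<Gamma> Q s"
proof (induction arbitrary: \<Gamma> s rule: scong.induct)
  case sc_nil
  show ?case
  proof
    assume "typed M \<Gamma> (PNil \<bowtie> PNil) s"
    then have "s ChL = End" "s ChR = End"
      by (auto simp: typed_iffs dest!: fun_cong split: if_splits)
    then show "typed M \<Gamma> PNil s"
      by (metis typed_PNil_iff chan.exhaust ext)
  \<comment> \<open>The middle type is \<open>End\<close>, its own dual.\<close>
  qed (force simp: typed_iffs)
next
  case (sc_assoc P Q R)
  \<comment> \<open>The central process \<open>Q\<close> has both channels reassigned, in opposite
    orders under the two bracketings.\<close>
  have "s(ChR := U, ChL := dual T) = s(ChL := dual T, ChR := U)" for T U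
    by (simp add: fun_upd_twist)
  then show ?case
    by (auto simp: typed_iffs)
qed (auto simp: typed_iffs)

text \<open>The first hypothesis ranges over all sessions because the hole is typed at intermediate
  types chosen inside the context; \<open>\<Gamma>\<close> stays fixed since contexts bind no
  variables.\<close>

lemma typed_plug:
  assumes "\<And>s. typed M \<Gamma> P s \<Longrightarrow> typed M \<Gamma> Q s" and "typed M \<Gamma> (plug C P) s"
  shows "typed M \<Gamma> (plug C Q) s"
  using assms(2) by (induction C arbitrary: s) (auto simp: typed_iffs assms(1))

text \<open>A communication strips the head of the middle type on one side and of its dual on the
  other, so the tails are again dual and the outer session is unchanged.\<close>

lemma red_typed: "red M P Q \<Longrightarrow> typed M \<Gamma> P s \<Longrightarrow> typed M \<Gamma> Q s"
proof (induction arbitrary: s rule: red.induct)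
  case (red_comm_right e v t P x Q)
  then show ?case by (auto simp: typed_iffs) (blast intro: typed_subst)
next
  case (red_comm_left e v t x P Q)
  then show ?case by (auto simp: typed_iffs intro: typed_subst)
next
  case (red_choice_right k P Q1 Q2)
  then show ?case by (cases k) (auto simp: typed_iffs)
next
  case (red_choice_left P1 P2 k Q)
  then show ?case by (cases k) (auto simp: typed_iffs)
next
  case (red_cond e b P Q)
  then show ?case by (auto simp: typed_iffs)
next
  case (red_ctx P Q C)
  then show ?case by (blast intro: typed_plug)
next
  case (red_struct P P' Q' Q)
  then show ?case by (metis scong_typed_iff)
qed

section \<open>Progress\<close>

text \<open>Only variables have no value, and the empty environment types none.\<close>

lemma etyped_closed_eval:
  assumes "etyped M Map.empty e t"
  obtains v where "e \<Down> v" and "has_btype M v t"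
  using assms
proof (induction e t arbitrary: thesis rule: etyped.induct)
  case (et_Eq e1 t e2)
  obtain v1 v2 where "e1 \<Down> v1" "e2 \<Down> v2"
    using et_Eq.IH by metis
  then show ?case
    using et_Eq.prems eval_Eq by fastforce
qed (auto intro: eval_Val)

fun prefix_on :: "chan \<Rightarrow> ('v, 't) proc \<Rightarrow> bool" where
  "prefix_on c (Inp d x t P) \<longleftrightarrow> d = c"
| "prefix_on c (Out d e P) \<longleftrightarrow> d = c"
| "prefix_on c (Sel d k P) \<longleftrightarrow> d = c"
| "prefix_on c (Bra d P Q) \<longleftrightarrow> d = c"
| "prefix_on c _ \<longleftrightarrow> False"

lemma prefix_on_not_End:
  assumes "prefix_on c A" and "typed M \<Gamma> A s"
  shows "s c \<noteq> End"
  using assms by (cases A) (auto simp: typed_iffs)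

text \<open>Typing ties the prefix to the head of its type, so duality leaves only the four matching
  pairs; a sent expression is closed and evaluates to a value of the type the receiver
  expects.\<close>

lemma dual_prefixes_red:
  assumes "prefix_on ChR A" and "prefix_on ChL B"
    and "typed M Map.empty A s" and "typed M Map.empty B s'"
    and "s' ChL = dual (s ChR)"
  shows "\<exists>X. red M (A \<bowtie> B) X"
  using assms
  by (cases A; cases B)
    (auto simp: typed_iffs elim!: etyped_closed_eval
      dest: red_comm_right red_comm_left intro: red_choice_right red_choice_left)

text \<open>The case \<open>P \<cong> A\<close> is separate because \<open>PNil\<close> is not a
  unit of \<open>\<bowtie>\<close>, so a neighbour \<open>R\<close> cannot always be
  supplied.\<close>

definition exposes :: "chan \<Rightarrow> ('v, 't) proc \<Rightarrow> ('v, 't) proc \<Rightarrow> bool" where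
  "exposes c A P \<longleftrightarrow> prefix_on c A \<and>
    (P \<cong> A \<or> (\<exists>R. P \<cong> (case c of ChL \<Rightarrow> A \<bowtie> R | ChR \<Rightarrow> R \<bowtie> A)))"

lemma prefix_on_exposes: "prefix_on c A \<Longrightarrow> exposes c A A"
  by (simp add: exposes_def sc_refl)

text \<open>Composition reassigns only the inner channel of an end component; its outer channel
  keeps the type of the whole.\<close>

lemma exposes_typed:
  assumes "exposes c A P" and "typed M \<Gamma> P s"
  shows "\<exists>s'. typed M \<Gamma> A s' \<and> s' c = s c"
proof (cases "P \<cong> A")
  case True
  then show ?thesis using assms(2) scong_typed_iff by blast
next
  case False
  then obtain R where "P \<cong> (case c of ChL \<Rightarrow> A \<bowtie> R | ChR \<Rightarrow> R \<bowtie> A)"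
    using assms(1) by (auto simp: exposes_def)
  then have "typed M \<Gamma> (case c of ChL \<Rightarrow> A \<bowtie> R | ChR \<Rightarrow> R \<bowtie> A) s"
    using assms(2) scong_typed_iff by blast
  then show ?thesis
    by (cases c) (auto simp: typed_Comp_iff intro: exI[of _ "s(ChL := _)"] exI[of _ "s(ChR := _)"])
qed

lemma exposes_not_End:
  assumes "exposes c A P" and "typed M \<Gamma> P s"
  shows "s c \<noteq> End"
  using assms exposes_typed prefix_on_not_End exposes_def by metis

lemma exposes_Comp_left: "exposes ChL A P \<Longrightarrow> exposes ChL A (P \<bowtie> Q)"
  by (auto simp: exposes_def) (meson sc_Comp sc_refl sc_assoc sc_sym sc_trans)+

lemma exposes_Comp_right: "exposes ChR A Q \<Longrightarrow> exposes ChR A (P \<bowtie> Q)"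
  by (auto simp: exposes_def) (meson sc_Comp sc_refl sc_assoc sc_sym sc_trans)+

lemma red_CompL: "red M P P' \<Longrightarrow> red M (P \<bowtie> Q) (P' \<bowtie> Q)"
  using red_ctx[of M P P' "CompL Hole Q"] by simp

lemma red_CompR: "red M Q Q' \<Longrightarrow> red M (P \<bowtie> Q) (P \<bowtie> Q')"
  using red_ctx[of M Q Q' "CompR P Hole"] by simp

text \<open>Associativity makes \<open>A\<close> and \<open>B\<close> adjacent; \<open>B\<close> is
  first extended to \<open>Q\<close>, then \<open>A\<close> to \<open>P\<close>.\<close>

lemma exposes_Comp_red:
  assumes "exposes ChR A P" and "exposes ChL B Q" and "red M (A \<bowtie> B) X"
  shows "\<exists>Y. red M (P \<bowtie> Q) Y"
proof -
  have extend: "\<exists>Y. red M (A \<bowtie> Q) Y"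
  proof (cases "Q \<cong> B")
    case True
    then show ?thesis by (meson assms(3) red_struct sc_Comp sc_refl)
  next
    case False
    then obtain R where "Q \<cong> B \<bowtie> R"
      using assms(2) by (auto simp: exposes_def)
    then have "A \<bowtie> Q \<cong> (A \<bowtie> B) \<bowtie> R"
      by (meson sc_Comp sc_refl sc_assoc sc_trans)
    then show ?thesis by (meson assms(3) red_struct red_CompL sc_refl)
  qed
  then obtain Y where Y: "red M (A \<bowtie> Q) Y" by blast
  show ?thesis
  proof (cases "P \<cong> A")
    case True
    then show ?thesis by (meson Y red_struct sc_Comp sc_refl)
  next
    case False
    then obtain R where "P \<cong> R \<bowtie> A"
      using assms(1) by (auto simp: exposes_def)
    then have "P \<bowtie> Q \<cong> R \<bowtie> (A \<bowtie> Q)"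
      by (meson sc_Comp sc_refl sc_assoc sc_sym sc_trans)
    then show ?thesis by (meson Y red_struct red_CompR sc_refl)
  qed
qed

lemma scong_PNil_typed:
  assumes "P \<cong> PNil" and "typed M \<Gamma> P s"
  shows "s c = End"
  using assms scong_typed_iff typed_PNil_iff by metis

theorem progress:
  assumes "typed M Map.empty P s" and "\<nexists>Q. red M P Q"
  shows "P \<cong> PNil \<or> (\<exists>c A. exposes c A P)"
  using assms
proof (induction P arbitrary: s)
  case PNil
  show ?case by (simp add: sc_refl)
next
  case (Cond e P Q)
  then have "etyped M Map.empty e BoolT"
    by (simp add: typed_Cond_iff)
  then obtain b where "e \<Down> VBool b"
    by (rule etyped_closed_eval) auto
  then show ?case using Cond.prems(2) red_cond by blast
next
  case (Comp P Q)
  obtain T where P: "typed M Map.empty P (s(ChR := T))"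
    and Q: "typed M Map.empty Q (s(ChL := dual T))"
    using Comp.prems(1) by (auto simp: typed_Comp_iff)
  have "P \<cong> PNil \<or> (\<exists>c A. exposes c A P)"
    using Comp.IH(1)[OF P] Comp.prems(2) red_CompL by blast
  then consider "P \<cong> PNil" | A where "exposes ChL A P" | A where "exposes ChR A P"
    by (metis chan.exhaust)
  then show ?case
  proof cases
    case 2
    then show ?thesis using exposes_Comp_left by blast
  next
    case left: 1
    then have [simp]: "T = End"
      using scong_PNil_typed[OF _ P, of ChR] by simp
    have "Q \<cong> PNil \<or> (\<exists>c A. exposes c A Q)"
      using Comp.IH(2)[OF Q] Comp.prems(2) red_CompR by blast
    then show ?thesis
    proof (elim disjE exE)
      assume "Q \<cong> PNil"
      then show ?thesis using left by (meson sc_Comp sc_nil sc_trans)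
    next
      fix c A assume A: "exposes c A Q"
      \<comment> \<open>\<open>Q\<close> has type \<open>End\<close> on \<open>ChL\<close>, so its
        exposed prefix is on \<open>ChR\<close>, the outer side.\<close>
      show ?thesis
        using A exposes_not_End[OF A Q] by (cases c) (auto dest: exposes_Comp_right)
    qed
  next
    case left: (3 A)
    have "Q \<cong> PNil \<or> (\<exists>c A. exposes c A Q)"
      using Comp.IH(2)[OF Q] Comp.prems(2) red_CompR by blast
    then show ?thesis
    proof (elim disjE exE)
      assume "Q \<cong> PNil"
      then have "dual T = End"
        using scong_PNil_typed[OF _ Q, of ChL] by simp
      moreover have "T \<noteq> End"
        using exposes_not_End[OF left P] by simp
      \<comment> \<open>Only \<open>End\<close> has dual \<open>End\<close>.\<close>
      ultimately show ?thesis by (cases T) auto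
    next
      fix c B assume B: "exposes c B Q"
      show ?thesis
      proof (cases c)
        case ChR
        then show ?thesis using B exposes_Comp_right by blast
      next
        case ChL
        obtain s1 s2 where "typed M Map.empty A s1" "s1 ChR = T"
          and "typed M Map.empty B s2" "s2 ChL = dual T"
          using exposes_typed[OF left P] exposes_typed[OF B Q] ChL by auto
        then have "\<exists>X. red M (A \<bowtie> B) X"
          using dual_prefixes_red left B ChL by (metis exposes_def)
        then show ?thesis
          using exposes_Comp_red left B ChL Comp.prems(2) by blast
      qed
    qed
  qed
\<comment> \<open>The remaining processes are prefixes, which expose themselves.\<close>
qed (metis prefix_on_exposes prefix_on.simps)+

theorem theorem1:
  fixes M :: "'v bval \<Rightarrow> 't \<Rightarrow> bool" and P :: "('v, 't) proc"
  assumes "typed M Map.empty P (session ChL End End)"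
  shows "correct M P"
  unfolding correct_def
proof (intro allI impI)
  fix Q assume Q: "(red M)\<^sup>*\<^sup>* P Q \<and> \<not> (\<exists>Q'. red M Q Q')"
  then have "(red M)\<^sup>*\<^sup>* P Q" by blast
  then have typed: "typed M Map.empty Q (session ChL End End)"
    by induction (use assms red_typed in blast)+
  moreover have "session ChL End End c = End" for c
    by (simp add: session_def)
  \<comment> \<open>An exposed prefix would contradict \<open>End\<close> on its channel.\<close>
  ultimately show "Q \<cong> PNil"
    using progress Q exposes_not_End by metis
qed

end
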